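(* Let $A$ be a PGC-algebra with commuting graph $G_c(A)$, and let $E$ be the edge set of $G_c(A)$. Suppose there exists a vertex ordering of $G_c(A)$ such that for any three vertices $a,b,c$ with $\{a,c\}\notin E$ and $\{a,b\},\{b,c\}\in E$, neither $a<b<c$ nor $c<b<a$ holds in the ordering. Then there exists a monomial ordering with respect to which all ambiguities of degree three of $A$ are resolvable (in the sense of the diamond lemma).
   Context: A PGC-algebra is an associative unital algebra $A$ over a field, with a given presentation by generators $a_1,\dots,a_n$ and a set of relations each of the form $[a_i,a_j]=a_ia_j-a_ja_i=0$ for some $i,j\in\{1,\dots,n\}$. Its commuting graph $G_c(A)$ is the simple graph with vertex set $\{a_1,\dots,a_n\}$ in which $\{a_i,a_j\}$ ($i\ne j$) is an edge iff $[a_i,a_j]=0$ in $A$ (equivalently, iff this commutator is one of the relations, up to sign). A vertex ordering of a graph with $n$ vertices is a surjective (hence bijective) map from its vertices onto $\{1,\dots,n\}$; vertices are compared via their images, and vertices $a,b,c$ in the statement are distinct. Diamond lemma terminology: a monomial ordering is a total well-ordering on words in the generators compatible with multiplication. Given one, each relation $a_ia_j-a_ja_i=0$ yields the reduction replacing its larger monomial by the smaller one. An ambiguity of degree three is a word $xyz$ of three generators such that both $xy$ and $yz$ are left-hand sides of reductions; it is resolvable if the two elements obtained by reducing $xy$ in $xyz$ and by reducing $yz$ in $xyz$ can be brought to a common element by further applications of reductions. *)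

theory Defs
  imports Complex_Main "HOL-Library.Cardinality" "HOL-Library.Poly_Mapping"
begin

text \<open>
  Words over an alphabet form the free monoid under concatenation, written additively because
  \<open>Poly_Mapping\<close> takes additive exponent monoids. With this instance the
  (convolution) ring structure on \<open>'g list \<Rightarrow>\<^sub>0 'k\<close> is that of the free associative
  algebra over \<open>'k\<close> on the generators \<open>'g\<close>.
\<close>

instantiation list :: (type) monoid_add
begin

definition zero_list :: "'a list" where "zero_list = []"

definition plus_list :: "'a list \<Rightarrow> 'a list \<Rightarrow> 'a list" where "plus_list u v = u @ v"

instance by standard (simp_all add: zero_list_def plus_list_def)

end

type_synonym ('g, 'k) free_algebra = "'g list \<Rightarrow>\<^sub>0 'k"

definition word :: "'g list \<Rightarrow> ('g, 'k::field) free_algebra" where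
  "word w = Poly_Mapping.single w 1"

lemma word_mult: "word u * word v = word (u @ v)"
  by (simp add: word_def mult_single plus_list_def)

lemma word_Nil: "word [] = 1"
  by (simp add: word_def zero_list_def flip: single_one)

definition commutator :: "'r::ring \<Rightarrow> 'r \<Rightarrow> 'r" where
  "commutator x y = x * y - y * x"

definition two_sided_ideal :: "'r::ring_1 set \<Rightarrow> bool" where
  "two_sided_ideal I \<longleftrightarrow> 0 \<in> I \<and> (\<forall>x\<in>I. \<forall>y\<in>I. x + y \<in> I) \<and>
     (\<forall>x\<in>I. \<forall>r. r * x \<in> I \<and> x * r \<in> I)"

locale assoc_algebra = vector_space scale
  for scale :: "'k::field \<Rightarrow> 'a::ring_1 \<Rightarrow> 'a" +
  assumes scale_mult_left: "scale c x * y = scale c (x * y)"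
    and scale_mult_right: "x * scale c y = scale c (x * y)"

definition eval_free :: "('k::field \<Rightarrow> 'a::ring_1 \<Rightarrow> 'a) \<Rightarrow> ('g \<Rightarrow> 'a) \<Rightarrow> ('g, 'k) free_algebra \<Rightarrow> 'a" where
  "eval_free scale a p =
     (\<Sum>w\<in>Poly_Mapping.keys p. scale (Poly_Mapping.lookup p w) (prod_list (map a w)))"

text \<open>
  \<open>pgc_algebra scale a R\<close>: the algebra on the type \<open>'a\<close> is presented by the generators
  \<open>a i\<close> and the relations \<open>a i * a j - a j * a i = 0\<close> for \<open>(i, j) \<in> R\<close>, i.e. evaluation
  induces an isomorphism from the free algebra modulo the ideal generated by the relators.
  The \<open>n\<close> generators are indexed by the finite type \<open>'g\<close>, so \<open>n = CARD('g)\<close>.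
\<close>

locale pgc_algebra = assoc_algebra scale
  for scale :: "'k::field \<Rightarrow> 'a::ring_1 \<Rightarrow> 'a" +
  fixes a :: "'g::finite \<Rightarrow> 'a" and R :: "('g \<times> 'g) set"
  assumes generators: "range (eval_free scale a) = UNIV"
    and relations: "{p. eval_free scale a p = 0} =
      two_sided_ideal hull {commutator (word [i]) (word [j]) | i j. (i, j) \<in> R}"

text \<open>The vertex \<open>a i\<close> of the commuting graph is represented by its index \<open>i\<close>.\<close>

definition commuting_edges :: "('g \<Rightarrow> 'a::ring_1) \<Rightarrow> 'g set set" where
  "commuting_edges a = {{i, j} | i j. i \<noteq> j \<and> commutator (a i) (a j) = 0}"

definition vertex_ordering :: "('g::finite \<Rightarrow> nat) \<Rightarrow> bool" where
  "vertex_ordering ord \<longleftrightarrow> range ord = {1..CARD('g)}"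

lemma vertex_ordering_bij: "vertex_ordering ord \<Longrightarrow> bij_betw ord UNIV {1..CARD('g)}"
  for ord :: "'g::finite \<Rightarrow> nat"
  unfolding vertex_ordering_def bij_betw_def by (auto intro: eq_card_imp_inj_on)

text \<open>Reflexive convention: \<open>(u, v) \<in> word_le\<close> means that \<open>u\<close> is at most \<open>v\<close>.\<close>

definition monomial_ordering :: "('g list \<times> 'g list) set \<Rightarrow> bool" where
  "monomial_ordering word_le \<longleftrightarrow> well_order_on UNIV word_le \<and>
     (\<forall>u v p q. (u, v) \<in> word_le \<longrightarrow> (p @ u @ q, p @ v @ q) \<in> word_le)"

text \<open>
  Pairs (larger monomial, smaller monomial) of the relations. A relation with \<open>i = j\<close> has no
  larger monomial and gives no rule.
\<close>

definition rules :: "('g list \<times> 'g list) set \<Rightarrow> ('g \<times> 'g) set \<Rightarrow> ('g list \<times> 'g list) set" where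
  "rules word_le R = {(l, r). r \<noteq> l \<and> (r, l) \<in> word_le \<and>
     (\<exists>i j. (i, j) \<in> R \<and> {l, r} = {[i, j], [j, i]})}"

text \<open>The linear map that sends the word \<open>u l v\<close> to \<open>u r v\<close> and fixes all other words.\<close>

definition reduction ::
    "'g list \<Rightarrow> 'g list \<times> 'g list \<Rightarrow> 'g list \<Rightarrow> ('g, 'k::field) free_algebra \<Rightarrow> ('g, 'k) free_algebra" where
  "reduction u rule v p = (case rule of (l, r) \<Rightarrow>
     let c = Poly_Mapping.lookup p (u @ l @ v)
     in p - Poly_Mapping.single (u @ l @ v) c + Poly_Mapping.single (u @ r @ v) c)"

definition reduces ::
    "('g list \<times> 'g list) set \<Rightarrow> ('g, 'k::field) free_algebra \<Rightarrow> ('g, 'k) free_algebra \<Rightarrow> bool" where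
  "reduces S p q \<longleftrightarrow> (\<exists>u. \<exists>rule\<in>S. \<exists>v. q = reduction u rule v p)"

definition ambiguity3 :: "('g list \<times> 'g list) set \<Rightarrow> 'g \<Rightarrow> 'g \<Rightarrow> 'g \<Rightarrow> bool" where
  "ambiguity3 S x y z \<longleftrightarrow> [x, y] \<in> fst ` S \<and> [y, z] \<in> fst ` S"

text \<open>The type argument fixes the coefficient field.\<close>

definition resolvable3 ::
    "'k::field itself \<Rightarrow> ('g list \<times> 'g list) set \<Rightarrow> 'g \<Rightarrow> 'g \<Rightarrow> 'g \<Rightarrow> bool" where
  "resolvable3 _ S x y z \<longleftrightarrow>
     (\<forall>f g. ([x, y], f) \<in> S \<longrightarrow> ([y, z], g) \<in> S \<longrightarrow>
       (\<exists>q :: ('g, 'k) free_algebra.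
          (reduces S)\<^sup>*\<^sup>* (reduction [] ([x, y], f) [z] (word [x, y, z])) q \<and>
          (reduces S)\<^sup>*\<^sup>* (reduction [x] ([y, z], g) [] (word [x, y, z])) q))"

end

theory Submission
  imports Defs
begin

text \<open>
  Order words by length and then lexicographically along the given vertex ordering. An ambiguity
  is then a word \<open>x y z\<close> with \<open>x > y > z\<close> in which \<open>x, y\<close> and \<open>y, z\<close> commute, so by hypothesis
  \<open>x, z\<close> commute as well. The point is that commuting generators are already related by \<open>R\<close>:
  if \<open>x z - z x\<close> were not a relator up to sign, then no element of the ideal of relations could
  involve the word \<open>x z\<close>. Hence all three transpositions are available, and both
  reductions of \<open>x y z\<close> can be sorted down to \<open>z y x\<close>.
\<close>

lemma commutator_word: "commutator (word u) (word v) = word (u @ v) - word (v @ u)"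
  by (simp add: commutator_def word_mult)

lemma keys_word: "Poly_Mapping.keys (word w :: ('g, 'k::field) free_algebra) = {w}"
  by (simp add: word_def)

text \<open>A word in the support of a product concatenates words from the two supports. As
  \<open>W\<close> is closed under passing to both pieces, such a word can lie in \<open>W\<close>
  only if each support meets \<open>W\<close>.\<close>

lemma two_sided_ideal_avoiding:
  assumes "\<And>u v. u @ v \<in> W \<Longrightarrow> u \<in> W \<and> v \<in> W"
  shows "two_sided_ideal {p :: ('g, 'k::field) free_algebra. Poly_Mapping.keys p \<inter> W = {}}"
proof -
  have "Poly_Mapping.keys (p * q) \<inter> W = {}"
    if "Poly_Mapping.keys p \<inter> W = {} \<or> Poly_Mapping.keys q \<inter> W = {}"
    for p q :: "('g, 'k) free_algebra"
    using that keys_mult[of p q] assms unfolding plus_list_def by blast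
  moreover have "Poly_Mapping.keys (p + q) \<inter> W = {}"
    if "Poly_Mapping.keys p \<inter> W = {}" "Poly_Mapping.keys q \<inter> W = {}"
    for p q :: "('g, 'k) free_algebra"
    using that Poly_Mapping.keys_add[of p q] by blast
  ultimately show ?thesis
    unfolding two_sided_ideal_def by simp
qed

context assoc_algebra
begin

text \<open>For distinct letters the two words do not cancel, so the sum defining
  \<open>eval_free\<close> has exactly two terms.\<close>

lemma eval_free_commutator:
  assumes "i \<noteq> j"
  shows "eval_free scale a (commutator (word [i]) (word [j])) = commutator (a i) (a j)"
proof -
  let ?p = "word [i, j] - word [j, i] :: ('b, 'k) free_algebra"
  have lookup: "Poly_Mapping.lookup ?p w = (if w = [i, j] then 1 else if w = [j, i] then -1 else 0)"
    for w
    using assms by (auto simp: word_def lookup_minus lookup_single when_def)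
  have "Poly_Mapping.keys ?p = {[i, j], [j, i]}"
    by (auto simp: in_keys_iff lookup split: if_splits)
  then have "eval_free scale a ?p = commutator (a i) (a j)"
    using assms by (simp add: eval_free_def lookup commutator_def)
  then show ?thesis
    by (simp add: commutator_word)
qed

end

context pgc_algebra
begin

lemma commutator_eq_0_if_related:
  assumes "(i, j) \<in> R" "i \<noteq> j"
  shows "commutator (a i) (a j) = 0"
proof -
  have "commutator (word [i]) (word [j]) \<in> {p. eval_free scale a p = 0}"
    unfolding relations using assms by (auto intro!: hull_inc)
  then show ?thesis
    using assms by (simp add: eval_free_commutator)
qed

lemma related_if_commutator_eq_0:
  assumes comm: "commutator (a i) (a j) = 0" and "i \<noteq> j"
  shows "(i, j) \<in> R \<or> (j, i) \<in> R"
proof (rule ccontr)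
  assume unrelated: "\<not> ?thesis"
  \<comment> \<open>All factors of \<open>[i, j]\<close>, hence closed under splitting. A relator
    meeting \<open>?W\<close> would contain the word \<open>[i, j]\<close>, so its index pair would
    be \<open>(i, j)\<close> or \<open>(j, i)\<close>.\<close>
  let ?W = "{[], [i], [j], [i, j]}"
  let ?J = "{p :: ('g, 'k) free_algebra. Poly_Mapping.keys p \<inter> ?W = {}}"
  have "two_sided_ideal ?J"
    by (rule two_sided_ideal_avoiding) (auto simp: append_eq_Cons_conv)
  moreover have "commutator (word [k]) (word [l]) \<in> ?J" if "(k, l) \<in> R" for k l
  proof (cases "k = l")
    case True
    then show ?thesis by (simp add: commutator_def)
  next
    case False
    have "Poly_Mapping.keys (commutator (word [k]) (word [l]) :: ('g, 'k) free_algebra)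
        \<subseteq> {[k, l], [l, k]}"
      unfolding commutator_word
      using Poly_Mapping.keys_diff[of "word ([k] @ [l]) :: ('g, 'k) free_algebra" "word ([l] @ [k])"]
      by (auto simp: keys_word)
    then show ?thesis
      using that unrelated by auto
  qed
  ultimately have "two_sided_ideal hull {commutator (word [k]) (word [l]) | k l. (k, l) \<in> R} \<subseteq> ?J"
    by (intro hull_minimal) auto
  moreover have "commutator (word [i]) (word [j]) \<in> {p. eval_free scale a p = 0}"
    using assms by (simp add: eval_free_commutator)
  ultimately have "commutator (word [i]) (word [j]) \<in> ?J"
    unfolding relations by blast
  moreover have "[i, j] \<in> Poly_Mapping.keys
      (commutator (word [i]) (word [j]) :: ('g, 'k) free_algebra)"
    unfolding commutator_word
    using \<open>i \<noteq> j\<close> by (simp add: in_keys_iff word_def lookup_minus lookup_single)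
  ultimately show False by blast
qed

text \<open>Links the graph, defined through the algebra, to \<open>R\<close>, which determines the
  rules. The disjunction reflects that a relator is given only up to sign.\<close>

lemma commuting_edges_iff:
  assumes "i \<noteq> j"
  shows "{i, j} \<in> commuting_edges a \<longleftrightarrow> (i, j) \<in> R \<or> (j, i) \<in> R"
proof -
  have "{i, j} \<in> commuting_edges a \<longleftrightarrow> commutator (a i) (a j) = 0"
    using assms by (auto simp: commuting_edges_def commutator_def doubleton_eq_iff)
  moreover have "commutator (a j) (a i) = 0 \<longleftrightarrow> commutator (a i) (a j) = 0"
    by (auto simp: commutator_def)
  ultimately show ?thesis
    using assms commutator_eq_0_if_related related_if_commutator_eq_0 by metis
qed

end

text \<open>Comparing lengths first gives well-foundedness, which dictionary order lacks in
  general.\<close>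

definition deglex :: "('g \<Rightarrow> nat) \<Rightarrow> ('g list \<times> 'g list) set" where
  "deglex ord = (lenlex (inv_image less_than ord))\<^sup>="

lemma monomial_ordering_deglex:
  assumes "inj ord"
  shows "monomial_ordering (deglex ord)"
proof -
  let ?r = "inv_image less_than ord"
  let ?L = "lenlex ?r"
  have wf: "wf ?L" and trans: "trans ?L"
    by (auto intro!: wf_lenlex wf_inv_image lenlex_transI trans_inv_image)
  then have irrefl: "irrefl ?L"
    by (auto simp: irrefl_def dest: wf_not_refl)
  have total: "total ?L"
    by (rule total_lenlex) (use assms in \<open>auto simp: total_on_def dest: injD intro: linorder_neqE_nat\<close>)
  have "well_order_on UNIV (?L\<^sup>=)"
  proof -
    have "antisym (?L\<^sup>=)"
      using irrefl trans by (auto simp: antisym_def irrefl_def dest: transD)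
    moreover have "?L\<^sup>= - Id = ?L"
      using irrefl by (auto simp: irrefl_def)
    ultimately show ?thesis
      using wf trans total
      by (auto simp: well_order_on_def linear_order_on_def partial_order_on_def preorder_on_def
          refl_on_def total_on_def)
  qed
  \<comment> \<open>A common context preserves a length difference and, at equal lengths, the
    comparison at the first differing letter.\<close>
  moreover have "(p @ u @ q, p @ v @ q) \<in> ?L" if "(u, v) \<in> ?L" for p q u v
  proof -
    have "(u @ q, v @ q) \<in> ?L"
      using that irrefl by (auto simp: lenlex_conv lex_append_rightI)
    then show ?thesis
      by (auto simp: lenlex_conv lex_append_leftI)
  qed
  ultimately show ?thesis
    unfolding monomial_ordering_def deglex_def by blast
qed

text \<open>The two words of a rule have equal length and distinct first letters, which therefore
  decide the orientation: every rule sorts an adjacent descending pair.\<close>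

lemma rules_deglex_iff:
  "(l, r) \<in> rules (deglex ord) R \<longleftrightarrow>
    (\<exists>x y. l = [x, y] \<and> r = [y, x] \<and> ord y < ord x \<and> ((x, y) \<in> R \<or> (y, x) \<in> R))"
  by (auto simp: rules_def deglex_def doubleton_eq_iff lenlex_conv)

lemma reduction_word: "reduction u (l, r) v (word (u @ l @ v)) = word (u @ r @ v)"
  by (simp add: reduction_def word_def)

lemma reduces_word:
  assumes "(l, r) \<in> S"
  shows "reduces S (word (u @ l @ v)) (word (u @ r @ v))"
  unfolding reduces_def using assms reduction_word by metis

text \<open>The two routes reversing a word by adjacent swaps close up to a hexagon:
  \<open>xyz -> yxz -> yzx -> zyx\<close> and \<open>xyz -> xzy -> zxy -> zyx\<close>.\<close>

lemma resolvable3_if_transpositions: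
  assumes S: "\<And>l r. (l, r) \<in> S \<Longrightarrow> \<exists>i j. l = [i, j] \<and> r = [j, i]"
    and xy: "([x, y], [y, x]) \<in> S" and xz: "([x, z], [z, x]) \<in> S" and yz: "([y, z], [z, y]) \<in> S"
  shows "resolvable3 TYPE('k::field) S x y z"
proof -
  let ?w = "word :: _ \<Rightarrow> (_, 'k) free_algebra"
  have "reduces S (?w [y, x, z]) (?w [y, z, x])" "reduces S (?w [x, z, y]) (?w [z, x, y])"
    "reduces S (?w [y, z, x]) (?w [z, y, x])" "reduces S (?w [z, x, y]) (?w [z, y, x])"
    using reduces_word[OF xz, of "[y]" "[]"] reduces_word[OF xz, of "[]" "[y]"]
      reduces_word[OF yz, of "[]" "[x]"] reduces_word[OF xy, of "[z]" "[]"] by simp_all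
  then have "(reduces S)\<^sup>*\<^sup>* (?w [y, x, z]) (?w [z, y, x])"
    and "(reduces S)\<^sup>*\<^sup>* (?w [x, z, y]) (?w [z, y, x])"
    by (meson converse_rtranclp_into_rtranclp r_into_rtranclp)+
  \<comment> \<open>A left-hand side determines its rule, so no other right-hand sides have to be
    considered.\<close>
  moreover have "f = [y, x]" if "([x, y], f) \<in> S" for f
    using S[OF that] by auto
  moreover have "g = [z, y]" if "([y, z], g) \<in> S" for g
    using S[OF that] by auto
  moreover have "reduction [] ([x, y], [y, x]) [z] (?w [x, y, z]) = ?w [y, x, z]"
    and "reduction [x] ([y, z], [z, y]) [] (?w [x, y, z]) = ?w [x, z, y]"
    using reduction_word[of "[]" "[x, y]" "[y, x]" "[z]"]
      reduction_word[of "[x]" "[y, z]" "[z, y]" "[]"] by simp_all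
  ultimately show ?thesis
    unfolding resolvable3_def by metis
qed

theorem proposition5p1:
  fixes scale :: "'k::field \<Rightarrow> 'a::ring_1 \<Rightarrow> 'a"
    and a :: "'g::finite \<Rightarrow> 'a"
    and R :: "('g \<times> 'g) set"
  assumes "pgc_algebra scale a R"
    and "\<exists>ord :: 'g \<Rightarrow> nat. vertex_ordering ord \<and>
      (\<forall>x y z. x \<noteq> y \<and> y \<noteq> z \<and> x \<noteq> z \<and>
         {x, z} \<notin> commuting_edges a \<and> {x, y} \<in> commuting_edges a \<and> {y, z} \<in> commuting_edges a
         \<longrightarrow> \<not> (ord x < ord y \<and> ord y < ord z) \<and> \<not> (ord z < ord y \<and> ord y < ord x))"
  shows "\<exists>word_le :: ('g list \<times> 'g list) set. monomial_ordering word_le \<and>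
      (\<forall>x y z. ambiguity3 (rules word_le R) x y z \<longrightarrow>
         resolvable3 TYPE('k) (rules word_le R) x y z)"
proof -
  interpret pgc_algebra scale a R by fact
  \<comment> \<open>The hypothesis is kept in contrapositive form for descending triples, the shape
    of every ambiguity.\<close>
  obtain ord :: "'g \<Rightarrow> nat" where "vertex_ordering ord"
    and no_middle: "\<And>x y z. \<lbrakk>x \<noteq> y; y \<noteq> z; x \<noteq> z; {x, y} \<in> commuting_edges a;
      {y, z} \<in> commuting_edges a; ord z < ord y; ord y < ord x\<rbrakk> \<Longrightarrow> {x, z} \<in> commuting_edges a"
    using assms(2) by blast
  then have "inj ord"
    using vertex_ordering_bij bij_betw_def by blast
  moreover have "resolvable3 TYPE('k) (rules (deglex ord) R) x y z"
    if "ambiguity3 (rules (deglex ord) R) x y z" for x y z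
  proof -
    have lt: "ord y < ord x" "ord z < ord y"
      and R: "(x, y) \<in> R \<or> (y, x) \<in> R" "(y, z) \<in> R \<or> (z, y) \<in> R"
      using that by (auto simp: ambiguity3_def rules_deglex_iff)
    then have "x \<noteq> y" "y \<noteq> z" "x \<noteq> z" by auto
    with lt R have "(x, z) \<in> R \<or> (z, x) \<in> R"
      using no_middle[of x y z] by (simp add: commuting_edges_iff)
    \<comment> \<open>By transitivity \<open>ord z < ord x\<close>, so the relation between
      \<open>x\<close> and \<open>z\<close> is oriented as the rule from \<open>[x, z]\<close> to
      \<open>[z, x]\<close>.\<close>
    with lt R show ?thesis
      by (intro resolvable3_if_transpositions) (auto simp: rules_deglex_iff)
  qed
  ultimately show ?thesis
    using monomial_ordering_deglex by blast
qed

end
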